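(* Let $p\in(\tfrac12,1)$. There exists a monotone isomorphism of the Bernoulli shifts $B(1-p,p)$ and $B(p,1-p)$. That is, there is a measurable map $\phi:\{0,1\}^{\mathbb Z}\to\{0,1\}^{\mathbb Z}$ such that: $\phi(x)_i\le x_i$ for all $x$ and all $i\in\mathbb Z$; $\phi\circ T=T\circ\phi$ holds on a set of full $(1-p,p)^{\mathbb Z}$-measure; the push-forward of $(1-p,p)^{\mathbb Z}$ under $\phi$ is $(p,1-p)^{\mathbb Z}$; and $\phi$ is invertible (on full-measure sets) with $\phi^{-1}$ a factor map from $B(p,1-p)$ to $B(1-p,p)$.
   Context: $\Omega=\{0,1\}^{\mathbb Z}$ and $T:\Omega\to\Omega$ is the left shift, $(Tx)_i=x_{i+1}$. For a probability vector $\mathbf p=(p_0,p_1)$ on $\{0,1\}$ ($p_0$ the probability of symbol $0$), $B(\mathbf p)=(\Omega,\mathbf p^{\mathbb Z},T)$ is the Bernoulli shift. Thus under $(1-p,p)^{\mathbb Z}$ each coordinate equals $1$ with probability $p$, and under $(p,1-p)^{\mathbb Z}$ each coordinate equals $1$ with probability $1-p$. A factor map from $B(\mathbf p)$ to $B(\mathbf q)$ is a measurable $\phi:\Omega\to\Omega$ pushing $\mathbf p^{\mathbb Z}$ to $\mathbf q^{\mathbb Z}$ with $\phi\circ T=T\circ\phi$ on a set of full $\mathbf p^{\mathbb Z}$-measure; an isomorphism is a factor map whose inverse is a factor map from $B(\mathbf q)$ to $B(\mathbf p)$; a factor map is monotone if $\phi(x)_i\le x_i$ for all $x\in\Omega$,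 $i\in\mathbb Z$. *)

theory Defs
  imports "HOL-Probability.Probability"
begin

text \<open>Omega = {0,1}^Z, encoded as int => bool (True = symbol 1).\<close>

definition bshift :: "(int \<Rightarrow> bool) \<Rightarrow> (int \<Rightarrow> bool)" where
  "bshift x = (\<lambda>i. x (i + 1))"

definition bernoulli_measure :: "real \<Rightarrow> (int \<Rightarrow> bool) measure" where
  "bernoulli_measure q = PiM UNIV (\<lambda>_. measure_pmf (bernoulli_pmf q))"

definition factor_map ::
  "(int \<Rightarrow> bool) measure \<Rightarrow> (int \<Rightarrow> bool) measure \<Rightarrow> ((int \<Rightarrow> bool) \<Rightarrow> (int \<Rightarrow> bool)) \<Rightarrow> bool" where
  "factor_map M N \<phi> \<longleftrightarrow> \<phi> \<in> measurable M N \<and> distr M N \<phi> = N \<and>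
     (AE x in M. \<phi> (bshift x) = bshift (\<phi> x))"

definition isomorphism ::
  "(int \<Rightarrow> bool) measure \<Rightarrow> (int \<Rightarrow> bool) measure \<Rightarrow> ((int \<Rightarrow> bool) \<Rightarrow> (int \<Rightarrow> bool)) \<Rightarrow> bool" where
  "isomorphism M N \<phi> \<longleftrightarrow> factor_map M N \<phi> \<and>
     (\<exists>\<psi>. factor_map N M \<psi> \<and> (AE x in M. \<psi> (\<phi> x) = x) \<and> (AE y in N. \<phi> (\<psi> y) = y))"

definition monotone_map :: "((int \<Rightarrow> bool) \<Rightarrow> (int \<Rightarrow> bool)) \<Rightarrow> bool" where
  "monotone_map \<phi> \<longleftrightarrow> (\<forall>x i. \<phi> x i \<le> x i)"

end

theory Submission
  imports Defs
begin

text \<open>Read \<open>0\<close> as an arriving customer and \<open>1\<close> as an offered service of a single-server queue. Since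
  \<open>p > 1/2\<close> the queue is stable, and \<open>\<phi>\<close> keeps exactly the services that are used, so it produces the
  departure process. By Burke's theorem the departures are again i.i.d., with the intensity
  \<open>1 - p\<close> of the arrivals. The inverse is the same construction conjugated by time
  reversal and exchange of symbols: the queue fed by the reversed departures never exceeds the
  original queue, and both have the same geometric law, so they agree almost surely, and the
  common queue allows one to recover the unused services.\<close>

subsection \<open>Bernoulli measures\<close>

lemma prob_space_bernoulli: "prob_space (bernoulli_measure q)"
  unfolding bernoulli_measure_def by (intro prob_space_PiM measure_pmf.prob_space_axioms)

lemma space_bernoulli [simp]: "space (bernoulli_measure q) = UNIV"
  by (simp add: bernoulli_measure_def space_PiM)

lemma sets_bernoulli:
  "sets (bernoulli_measure q) = sets (PiM UNIV (\<lambda>_. count_space UNIV))"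
  unfolding bernoulli_measure_def by (intro sets_PiM_cong) auto

lemma measurable_bernoulli_cong:
  "measurable (bernoulli_measure q) N = measurable (PiM UNIV (\<lambda>_. count_space UNIV)) N"
  "measurable N (bernoulli_measure q) = measurable N (PiM UNIV (\<lambda>_. count_space UNIV))"
  by (auto intro!: measurable_cong_sets sets_bernoulli)

lemma coordinate_measurable [measurable]:
  "(\<lambda>x. x i) \<in> measurable (bernoulli_measure q) (count_space UNIV)"
  by (simp add: measurable_bernoulli_cong measurable_component_singleton)

lemma prob_bernoulli_pmf:
  assumes "0 \<le> q" "q \<le> 1"
  shows "measure_pmf.prob (bernoulli_pmf q) A =
    (if True \<in> A then q else 0) + (if False \<in> A then 1 - q else 0)"
proof -
  have "measure_pmf.prob (bernoulli_pmf q) A = sum (pmf (bernoulli_pmf q)) A"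
    by (intro measure_measure_pmf_finite) auto
  also have "\<dots> = (\<Sum>b\<in>UNIV. if b \<in> A then pmf (bernoulli_pmf q) b else 0)"
    by (simp add: sum.If_cases)
  also have "\<dots> = (if True \<in> A then q else 0) + (if False \<in> A then 1 - q else 0)"
    using assms by (simp add: UNIV_bool)
  finally show ?thesis .
qed

text \<open>Resampling coordinate \<open>i\<close> by an independent bit preserves the product
  measure. Since \<open>P\<close> ignores that coordinate, the event pulls back under the resampling
  to the rectangle \<open>{c} \<times> {x. P x}\<close>.\<close>

lemma bernoulli_independent_coordinate:
  assumes q: "0 \<le> q" "q \<le> 1"
    and meas: "Measurable.pred (bernoulli_measure q) P"
    and inv: "\<And>x b. P (x(i := b)) = P x"
  shows "measure (bernoulli_measure q) {x. P x \<and> x i = c} =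
    (if c then q else 1 - q) * measure (bernoulli_measure q) {x. P x}"
proof -
  let ?M = "bernoulli_measure q" and ?B = "measure_pmf (bernoulli_pmf q)"
  interpret M: prob_space ?M by (rule prob_space_bernoulli)
  have pred_sets: "{x. P x} \<in> sets ?M"
    using meas by (simp add: pred_def)
  have "{x. P x \<and> x i = c} = {x \<in> space ?M. P x \<and> x i = c}" by simp
  also have "\<dots> \<in> sets ?M" using meas by measurable
  finally have sets: "{x. P x \<and> x i = c} \<in> sets ?M" .
  have upd: "(\<lambda>(b, x). x(i := b)) \<in> measurable (?B \<Otimes>\<^sub>M ?M) ?M"
  proof -
    have "(\<lambda>z. ((snd z)(i := fst z)) j) \<in> measurable (?B \<Otimes>\<^sub>M ?M) (count_space UNIV)" for j
    proof (cases "j = i")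
      case True
      then show ?thesis
        using measurable_fst[of ?B ?M]
        by (simp add: measurable_cong_sets[OF refl sets_measure_pmf_count_space])
    next
      case False
      then show ?thesis
        using measurable_compose[OF measurable_snd coordinate_measurable] by simp
    qed
    then have "(\<lambda>z j. ((snd z)(i := fst z)) j)
        \<in> measurable (?B \<Otimes>\<^sub>M ?M) (PiM UNIV (\<lambda>_. count_space UNIV))"
      by (intro measurable_PiM_single') auto
    then show ?thesis
      by (simp add: measurable_bernoulli_cong(2) case_prod_beta' fun_upd_def)
  qed
  have "?M = distr (?B \<Otimes>\<^sub>M ?M) ?M (\<lambda>(b, x). x(i := b))"
    using distr_pair_PiM_eq_PiM[where I=UNIV and M="\<lambda>_::int. ?B" and i'=i]
    by (simp add: bernoulli_measure_def measure_pmf.prob_space_axioms)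
  then have "emeasure ?M {x. P x \<and> x i = c} =
      emeasure (distr (?B \<Otimes>\<^sub>M ?M) ?M (\<lambda>(b, x). x(i := b))) {x. P x \<and> x i = c}"
    by simp
  also have "\<dots> = emeasure (?B \<Otimes>\<^sub>M ?M)
      ((\<lambda>(b, x). x(i := b)) -` {x. P x \<and> x i = c} \<inter> space (?B \<Otimes>\<^sub>M ?M))"
    by (rule emeasure_distr[OF upd sets])
  also have "(\<lambda>(b, x). x(i := b)) -` {x. P x \<and> x i = c} \<inter> space (?B \<Otimes>\<^sub>M ?M) = {c} \<times> {x. P x}"
    by (auto simp: inv space_pair_measure)
  also have "emeasure (?B \<Otimes>\<^sub>M ?M) ({c} \<times> {x. P x}) = emeasure ?B {c} * emeasure ?M {x. P x}"
    by (rule M.emeasure_pair_measure_Times) (use pred_sets in auto)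
  finally have "measure ?M {x. P x \<and> x i = c} = measure ?B {c} * measure ?M {x. P x}"
    by (simp add: measure_def enn2real_mult)
  then show ?thesis
    using q by (cases c) (simp_all add: measure_pmf_single)
qed

lemma bernoulli_measure_eqI:
  assumes sets: "sets N = sets (bernoulli_measure q)"
    and eq: "\<And>J A. finite J \<Longrightarrow>
      emeasure N {x. \<forall>j\<in>J. x j \<in> A j} = ennreal (\<Prod>j\<in>J. measure_pmf.prob (bernoulli_pmf q) (A j))"
  shows "N = bernoulli_measure q"
proof -
  interpret product_prob_space "\<lambda>_::int. measure_pmf (bernoulli_pmf q)" UNIV
    by unfold_locales
  show ?thesis
    unfolding bernoulli_measure_def
  proof (rule PiM_eq)
    show "sets N = sets (PiM UNIV (\<lambda>_. measure_pmf (bernoulli_pmf q)))"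
      using sets by (simp add: bernoulli_measure_def)
    fix J :: "int set" and A :: "int \<Rightarrow> bool set"
    assume "finite J"
    moreover have "prod_emb UNIV (\<lambda>_. measure_pmf (bernoulli_pmf q)) J (Pi\<^sub>E J A) =
        {x. \<forall>j\<in>J. x j \<in> A j}"
      by (auto simp: prod_emb_def PiE_iff restrict_def)
    ultimately show "emeasure N (prod_emb UNIV (\<lambda>_. measure_pmf (bernoulli_pmf q)) J (Pi\<^sub>E J A)) =
        (\<Prod>j\<in>J. emeasure (measure_pmf (bernoulli_pmf q)) (A j))"
      by (simp add: eq prod_ennreal measure_pmf.emeasure_eq_measure)
  qed
qed

lemma emeasure_bernoulli_cylinder:
  assumes "finite J"
  shows "emeasure (bernoulli_measure q) {x. \<forall>j\<in>J. x j \<in> A j} =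
    ennreal (\<Prod>j\<in>J. measure_pmf.prob (bernoulli_pmf q) (A j))"
proof -
  interpret product_prob_space "\<lambda>_::int. measure_pmf (bernoulli_pmf q)" UNIV
    by unfold_locales
  show ?thesis
    using emeasure_PiM_Collect[of J A] assms
    by (simp add: bernoulli_measure_def space_PiM prod_ennreal measure_pmf.emeasure_eq_measure)
qed

subsection \<open>Time reversal\<close>

text \<open>The negation exchanges arrivals and services, so this involution swaps the parameters
  \<open>q\<close> and \<open>1 - q\<close>.\<close>

definition reversal :: "(int \<Rightarrow> bool) \<Rightarrow> (int \<Rightarrow> bool)" where
  "reversal x = (\<lambda>i. \<not> x (- i))"

lemma reversal_reversal [simp]: "reversal (reversal x) = x"
  by (simp add: reversal_def)

lemma reversal_measurable:
  "reversal \<in> measurable (bernoulli_measure q) (bernoulli_measure q')"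
proof -
  have "(\<lambda>x i. \<not> x (- i)) \<in> measurable (PiM UNIV (\<lambda>_::int. count_space UNIV)) (PiM UNIV (\<lambda>_::int. count_space UNIV))"
    by (rule measurable_PiM_single') auto
  then show ?thesis
    by (simp add: measurable_bernoulli_cong reversal_def[abs_def])
qed

lemma distr_reversal:
  assumes "0 \<le> q" "q \<le> 1"
  shows "distr (bernoulli_measure q) (bernoulli_measure (1 - q)) reversal = bernoulli_measure (1 - q)"
proof (rule bernoulli_measure_eqI)
  fix J :: "int set" and A :: "int \<Rightarrow> bool set"
  assume J: "finite J"
  let ?A = "\<lambda>j. Not ` A (- j)"
  have "emeasure (distr (bernoulli_measure q) (bernoulli_measure (1 - q)) reversal)
      {x. \<forall>j\<in>J. x j \<in> A j} =
    emeasure (bernoulli_measure q) {x. \<forall>j\<in>uminus ` J. x j \<in> ?A j}"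
  proof (subst emeasure_distr[OF reversal_measurable])
    have "{x. \<forall>j\<in>J. x j \<in> A j} = {x \<in> space (bernoulli_measure (1 - q)). \<forall>j\<in>J. x j \<in> A j}"
      by simp
    also have "\<dots> \<in> sets (bernoulli_measure (1 - q))"
      using J by measurable
    finally show "{x. \<forall>j\<in>J. x j \<in> A j} \<in> sets (bernoulli_measure (1 - q))" .
    have "(\<not> x) \<in> A j \<longleftrightarrow> x \<in> Not ` A j" for x j
      by force
    then have "reversal -` {x. \<forall>j\<in>J. x j \<in> A j} = {x. \<forall>j\<in>uminus ` J. x j \<in> ?A j}"
      by (auto simp: reversal_def)
    then show "emeasure (bernoulli_measure q)
        (reversal -` {x. \<forall>j\<in>J. x j \<in> A j} \<inter> space (bernoulli_measure q)) =
      emeasure (bernoulli_measure q) {x. \<forall>j\<in>uminus ` J. x j \<in> ?A j}"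
      by simp
  qed
  also have "\<dots> = ennreal (\<Prod>j\<in>uminus ` J. measure_pmf.prob (bernoulli_pmf q) (?A j))"
    using J by (intro emeasure_bernoulli_cylinder) auto
  also have "(\<Prod>j\<in>uminus ` J. measure_pmf.prob (bernoulli_pmf q) (?A j)) =
      (\<Prod>j\<in>J. measure_pmf.prob (bernoulli_pmf q) (Not ` A j))"
    by (subst prod.reindex) (auto simp: inj_on_def)
  also have "\<dots> = (\<Prod>j\<in>J. measure_pmf.prob (bernoulli_pmf (1 - q)) (A j))"
  proof (rule prod.cong)
    fix j
    have "True \<in> Not ` A j \<longleftrightarrow> False \<in> A j" "False \<in> Not ` A j \<longleftrightarrow> True \<in> A j"
      by force+
    then show "measure_pmf.prob (bernoulli_pmf q) (Not ` A j) =
        measure_pmf.prob (bernoulli_pmf (1 - q)) (A j)"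
      using assms by (simp add: prob_bernoulli_pmf)
  qed simp
  finally show "emeasure (distr (bernoulli_measure q) (bernoulli_measure (1 - q)) reversal)
      {x. \<forall>j\<in>J. x j \<in> A j} = ennreal (\<Prod>j\<in>J. measure_pmf.prob (bernoulli_pmf (1 - q)) (A j))" .
qed simp

subsection \<open>The queue and its departures\<close>

text \<open>The queue length just before time \<open>i\<close> if the queue is empty at time \<open>i - n\<close>; truncated
  subtraction on the naturals expresses that a service offered to an empty queue is lost.\<close>

primrec queue :: "nat \<Rightarrow> (int \<Rightarrow> bool) \<Rightarrow> int \<Rightarrow> nat" where
  "queue 0 x i = 0"
| "queue (Suc n) x i = (if x (i - 1) then queue n x (i - 1) - 1 else queue n x (i - 1) + 1)"

text \<open>The stationary queue, which is the supremum of \<open>queue n x i\<close> over \<open>n\<close>, has length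
  at least \<open>k\<close>. This formulation avoids the null set where that supremum is infinite.\<close>

definition queue_ge :: "nat \<Rightarrow> (int \<Rightarrow> bool) \<Rightarrow> int \<Rightarrow> bool" where
  "queue_ge k x i \<longleftrightarrow> (\<exists>n. k \<le> queue n x i)"

text \<open>Total on all configurations, so monotonicity and shift equivariance hold everywhere and
  not only almost surely.\<close>

definition departures :: "(int \<Rightarrow> bool) \<Rightarrow> (int \<Rightarrow> bool)" where
  "departures x = (\<lambda>i. x i \<and> queue_ge 1 x i)"

text \<open>When the later queue starts empty, the one started a step earlier has length at least 0;
  adding one and truncated subtraction of one both preserve the order.\<close>

lemma queue_mono_Suc: "queue n x i \<le> queue (Suc n) x i"
proof (induction n arbitrary: i)
  case (Suc n)
  then show ?case
    using Suc[of "i - 1"]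
    by (simp del: queue.simps(2) add: queue.simps(2)[of _ x i] diff_le_mono)
qed simp

lemma queue_ge_0 [simp]: "queue_ge 0 x i"
  by (simp add: queue_ge_def)

lemma queue_ge_antimono: "queue_ge l x i \<Longrightarrow> k \<le> l \<Longrightarrow> queue_ge k x i"
  unfolding queue_ge_def using le_trans by blast

text \<open>The queue recursion passes to the supremum: by monotonicity in \<open>n\<close>, a
  witness may be taken of the form \<open>Suc n\<close>, and then one step of \<open>queue\<close>
  unfolds.\<close>

lemma queue_ge_step:
  "queue_ge (Suc k) x (i + 1) \<longleftrightarrow> (if x i then queue_ge (Suc (Suc k)) x i else queue_ge k x i)"
proof -
  have "queue_ge (Suc k) x (i + 1) \<longleftrightarrow> (\<exists>n. Suc k \<le> queue (Suc n) x (i + 1))"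
    unfolding queue_ge_def using queue_mono_Suc[of _ x "i + 1"] le_trans by blast
  also have "\<dots> \<longleftrightarrow> (\<exists>n. if x i then Suc (Suc k) \<le> queue n x i else k \<le> queue n x i)"
    by (intro arg_cong[where f=Ex] ext) auto
  finally show ?thesis
    by (simp add: queue_ge_def)
qed

text \<open>Causality: the queue just before time \<open>i\<close> reads only coordinates below
  \<open>i\<close>, which makes it independent of \<open>x i\<close>. For \<open>departures\<close>
  the inequality becomes strict, because a departure at \<open>i\<close> also reads
  \<open>x i\<close>.\<close>

lemma queue_fun_upd: "i \<le> j \<Longrightarrow> queue n (x(j := b)) i = queue n x i"
  by (induction n arbitrary: i) auto

lemma queue_ge_fun_upd: "i \<le> j \<Longrightarrow> queue_ge k (x(j := b)) i = queue_ge k x i"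
  by (simp add: queue_ge_def queue_fun_upd)

lemma departures_fun_upd: "i < j \<Longrightarrow> departures (x(j := b)) i = departures x i"
  by (simp add: departures_def queue_ge_fun_upd)

lemma queue_bshift: "queue n (bshift x) i = queue n x (i + 1)"
  by (induction n arbitrary: i) (auto simp: bshift_def)

lemma departures_bshift: "departures (bshift x) = bshift (departures x)"
  unfolding departures_def queue_ge_def queue_bshift by (simp add: bshift_def)

lemma queue_measurable [measurable]:
  "(\<lambda>x. queue n x i) \<in> measurable (bernoulli_measure q) (count_space UNIV)"
  by (induction n arbitrary: i) (simp_all, measurable)

lemma queue_ge_measurable [measurable]:
  "Measurable.pred (bernoulli_measure q) (\<lambda>x. queue_ge k x i)"
  unfolding queue_ge_def by measurable

lemma departures_coordinate_measurable [measurable]: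
  "Measurable.pred (bernoulli_measure q) (\<lambda>x. departures x i)"
  unfolding departures_def by measurable

lemma departures_measurable:
  "departures \<in> measurable (bernoulli_measure q) (bernoulli_measure q')"
proof -
  have "(\<lambda>x i. departures x i) \<in> measurable (bernoulli_measure q) (PiM UNIV (\<lambda>_::int. count_space UNIV))"
    by (rule measurable_PiM_single') (use departures_coordinate_measurable in auto)
  then show ?thesis
    by (simp add: measurable_bernoulli_cong(2))
qed

subsection \<open>The stationary law of the queue\<close>

text \<open>Condition on \<open>x i\<close>, which is independent of the queue before it: to end
  with length at least \<open>k + 1\<close>, a service needs at least \<open>k + 2\<close>
  beforehand and an arrival at least \<open>k\<close>.\<close>

lemma prob_queue_ge_Suc:
  assumes "0 \<le> p" "p \<le> 1"
  shows "measure (bernoulli_measure p) {x. Suc k \<le> queue (Suc n) x (i + 1)} =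
    p * measure (bernoulli_measure p) {x. Suc (Suc k) \<le> queue n x i} +
    (1 - p) * measure (bernoulli_measure p) {x. k \<le> queue n x i}"
proof -
  interpret prob_space "bernoulli_measure p" by (rule prob_space_bernoulli)
  have indep: "prob {x. l \<le> queue n x i \<and> x i = c} = (if c then p else 1 - p) * prob {x. l \<le> queue n x i}"
    for l c
  proof (rule bernoulli_independent_coordinate[OF assms])
    show "Measurable.pred (bernoulli_measure p) (\<lambda>x. l \<le> queue n x i)"
      by measurable
    show "(l \<le> queue n (x(i := b)) i) = (l \<le> queue n x i)" for x b
      by (simp only: queue_fun_upd[OF order_refl])
  qed
  have sets: "{x. l \<le> queue n x i \<and> x i = c} \<in> sets (bernoulli_measure p)" for l c
  proof -
    have "{x \<in> space (bernoulli_measure p). l \<le> queue n x i \<and> x i = c} \<in> sets (bernoulli_measure p)"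
      by measurable
    then show ?thesis
      by simp
  qed
  have "{x. Suc k \<le> queue (Suc n) x (i + 1)} =
      {x. Suc (Suc k) \<le> queue n x i \<and> x i = True} \<union> {x. k \<le> queue n x i \<and> x i = False}"
    by auto
  moreover have "prob ({x. Suc (Suc k) \<le> queue n x i \<and> x i = True} \<union> {x. k \<le> queue n x i \<and> x i = False}) =
      prob {x. Suc (Suc k) \<le> queue n x i \<and> x i = True} + prob {x. k \<le> queue n x i \<and> x i = False}"
    by (rule finite_measure_Union[OF sets sets]) blast
  ultimately show ?thesis
    using indep[of "Suc (Suc k)" True] indep[of k False] by (simp only: if_True if_False)
qed

text \<open>Induction through the one-step equation, whose coefficients do not depend on the time.
  It allows that equation to be read at a single time \<open>i\<close>.\<close>

lemma prob_queue_ge_stationary: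
  assumes "0 \<le> p" "p \<le> 1"
  shows "measure (bernoulli_measure p) {x. k \<le> queue n x i} =
    measure (bernoulli_measure p) {x. k \<le> queue n x j}"
proof (induction n arbitrary: k i j)
  case (Suc n)
  show ?case
  proof (cases k)
    case (Suc l)
    show ?thesis
      unfolding Suc
      using prob_queue_ge_Suc[OF assms, of l n "i - 1"] prob_queue_ge_Suc[OF assms, of l n "j - 1"]
        Suc.IH[of "Suc (Suc l)" "i - 1" "j - 1"] Suc.IH[of l "i - 1" "j - 1"]
      by (simp del: queue.simps)
  qed simp
qed simp

text \<open>The geometric tails are a fixed point of the one-step equation, the empty queue lies
  below them, and the equation has nonnegative coefficients, so the bound persists.\<close>

lemma prob_queue_ge_le:
  assumes p: "1/2 < p" "p < 1"
  shows "measure (bernoulli_measure p) {x. k \<le> queue n x i} \<le> ((1 - p) / p) ^ k"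
proof (induction n arbitrary: k i)
  case 0
  interpret prob_space "bernoulli_measure p" by (rule prob_space_bernoulli)
  show ?case using p by (cases k) auto
next
  case (Suc n)
  interpret prob_space "bernoulli_measure p" by (rule prob_space_bernoulli)
  show ?case
  proof (cases k)
    case (Suc l)
    let ?r = "(1 - p) / p"
    have "prob {x. k \<le> queue (Suc n) x i} =
        p * prob {x. Suc (Suc l) \<le> queue n x (i - 1)} + (1 - p) * prob {x. l \<le> queue n x (i - 1)}"
      unfolding Suc using prob_queue_ge_Suc[of p l n "i - 1"] p by simp
    also have "\<dots> \<le> p * ?r ^ Suc (Suc l) + (1 - p) * ?r ^ l"
      using p by (intro add_mono mult_left_mono Suc.IH) auto
    also have "\<dots> = ?r ^ k"
    \<comment> \<open>With \<open>p * ?r = 1 - p\<close> the summands become the fractions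
      \<open>1 - p\<close> and \<open>p\<close> of \<open>?r ^ Suc l\<close>.\<close>
    proof -
      have "p * ?r ^ Suc (Suc l) = (1 - p) * ?r ^ Suc l" "(1 - p) * ?r ^ l = p * ?r ^ Suc l"
        using p by auto
      then show ?thesis
        unfolding Suc by (simp only:) (simp add: ring_distribs(2)[symmetric] del: power_Suc)
    qed
    finally show ?thesis .
  qed (use p in simp)
qed

lemma prob_queue_ge_limit:
  "(\<lambda>n. measure (bernoulli_measure p) {x. k \<le> queue n x i})
    \<longlonglongrightarrow> measure (bernoulli_measure p) {x. queue_ge k x i}"
proof -
  interpret prob_space "bernoulli_measure p" by (rule prob_space_bernoulli)
  have "{x. k \<le> queue n x i} = {x \<in> space (bernoulli_measure p). k \<le> queue n x i}" for n
    by simp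
  also have "\<dots> n \<in> sets (bernoulli_measure p)" for n
    by measurable
  finally have "range (\<lambda>n. {x. k \<le> queue n x i}) \<subseteq> sets (bernoulli_measure p)"
    by auto
  moreover have "incseq (\<lambda>n. {x. k \<le> queue n x i})"
    by (rule incseq_SucI) (use queue_mono_Suc le_trans in blast)
  ultimately have "(\<lambda>n. prob {x. k \<le> queue n x i}) \<longlonglongrightarrow> prob (\<Union>n. {x. k \<le> queue n x i})"
    by (rule finite_Lim_measure_incseq)
  moreover have "(\<Union>n. {x. k \<le> queue n x i}) = {x. queue_ge k x i}"
    by (auto simp: queue_ge_def)
  ultimately show ?thesis by simp
qed

text \<open>The tail probabilities \<open>g k\<close> satisfy \<open>g (k + 1) = p * g (k + 2) + (1 - p) * g k\<close>, whose solutions are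
  \<open>a + b * r ^ k\<close> with \<open>r = (1 - p) / p\<close>; the bound for the finite queues forces \<open>a = 0\<close>.\<close>

lemma prob_queue_ge:
  assumes p: "1/2 < p" "p < 1"
  shows "measure (bernoulli_measure p) {x. queue_ge k x i} = ((1 - p) / p) ^ k"
proof -
  interpret prob_space "bernoulli_measure p" by (rule prob_space_bernoulli)
  define r where "r = (1 - p) / p"
  have r: "0 < r" "r < 1" "p * r = 1 - p"
    using p by (auto simp: r_def field_simps)
  define g where "g k = prob {x. queue_ge k x i}" for k
  have g0: "g 0 = 1"
    using prob_space by (simp add: g_def)
  \<comment> \<open>Limit of the one-step equation, its right side moved from time
    \<open>i - 1\<close> to \<open>i\<close> by stationarity.\<close>
  have g_rec: "g (Suc k) = p * g (Suc (Suc k)) + (1 - p) * g k" for k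
  proof -
    have "(\<lambda>n. prob {x. Suc k \<le> queue (Suc n) x i}) \<longlonglongrightarrow> g (Suc k)"
      unfolding g_def by (rule LIMSEQ_Suc[OF prob_queue_ge_limit])
    moreover have "prob {x. Suc k \<le> queue (Suc n) x i} =
        p * prob {x. Suc (Suc k) \<le> queue n x i} + (1 - p) * prob {x. k \<le> queue n x i}" for n
      using prob_queue_ge_Suc[of p k n "i - 1"] p
        prob_queue_ge_stationary[of p "Suc (Suc k)" n "i - 1" i]
        prob_queue_ge_stationary[of p k n "i - 1" i]
      by (simp del: queue.simps)
    moreover have "(\<lambda>n. p * prob {x. Suc (Suc k) \<le> queue n x i} + (1 - p) * prob {x. k \<le> queue n x i})
        \<longlonglongrightarrow> p * g (Suc (Suc k)) + (1 - p) * g k"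
      unfolding g_def by (intro tendsto_intros prob_queue_ge_limit)
    ultimately show ?thesis
      using LIMSEQ_unique by simp
  qed
  have g_le: "g k \<le> r ^ k" for k
    unfolding g_def r_def
    by (rule LIMSEQ_le_const2[OF prob_queue_ge_limit]) (use prob_queue_ge_le[OF p] in blast)
  \<comment> \<open>The second-order recursion is a first-order one for the differences, with ratio
    \<open>(1 - p) / p = r\<close>.\<close>
  have diff: "g k - g (Suc k) = r ^ k * (1 - g 1)" for k
  proof (induction k)
    case (Suc k)
    have "p * (g (Suc k) - g (Suc (Suc k))) = (1 - p) * (g k - g (Suc k))"
      using g_rec[of k] by (simp add: algebra_simps)
    also have "\<dots> = p * (r ^ Suc k * (1 - g 1))"
      by (simp add: Suc r(3)[symmetric])
    finally show ?case
      using p by simp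
  qed (simp add: g0)
  \<comment> \<open>The differences summed as a geometric series. Letting \<open>k\<close> tend to
    infinity below determines the remaining unknown, \<open>g 1 = r\<close>.\<close>
  have closed: "(1 - r) * (1 - g k) = (1 - r ^ k) * (1 - g 1)" for k
  proof (induction k)
    case (Suc k)
    have "(1 - r) * (1 - g (Suc k)) = (1 - r) * (1 - g k) + (1 - r) * (g k - g (Suc k))"
      by (simp add: algebra_simps)
    also have "\<dots> = (1 - r ^ Suc k) * (1 - g 1)"
      by (simp add: Suc diff) (simp add: algebra_simps)
    finally show ?case .
  qed (simp add: g0)
  have r_lim: "(\<lambda>k. r ^ k) \<longlonglongrightarrow> 0"
    using r by (intro LIMSEQ_realpow_zero) auto
  have "g \<longlonglongrightarrow> 0"
    by (rule tendsto_sandwich[OF _ _ tendsto_const r_lim]) (auto simp: g_le, simp add: g_def)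
  then have "(\<lambda>k. (1 - r) * (1 - g k)) \<longlonglongrightarrow> (1 - r) * (1 - 0)"
    by (intro tendsto_intros)
  moreover have "(\<lambda>k. (1 - r ^ k) * (1 - g 1)) \<longlonglongrightarrow> (1 - 0) * (1 - g 1)"
    by (intro tendsto_intros r_lim)
  ultimately have "1 - r = 1 - g 1"
    unfolding closed using LIMSEQ_unique by fastforce
  then have "(1 - r) * (1 - g k) = (1 - r) * (1 - r ^ k)"
    using closed[of k] by (simp add: mult.commute)
  then have "g k = r ^ k"
    using r by simp
  then show ?thesis
    by (simp add: g_def r_def)
qed

subsection \<open>Burke's theorem\<close>

text \<open>The induction carries more than the law of the departures: the current queue is
  independent of the departures so far and still geometric. This is what makes the next departure
  independent of the earlier ones.\<close>

lemma prob_departures_queue_ge: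
  fixes A :: "int \<Rightarrow> bool set"
  assumes p: "1/2 < p" "p < 1"
  shows "measure (bernoulli_measure p)
      {x. (\<forall>j\<in>{m..<m + int n}. departures x j \<in> A j) \<and> queue_ge k x (m + int n)} =
    (\<Prod>j\<in>{m..<m + int n}. measure_pmf.prob (bernoulli_pmf (1 - p)) (A j)) * ((1 - p) / p) ^ k"
proof (induction n arbitrary: k)
  case 0
  then show ?case using prob_queue_ge[OF p] by simp
next
  case (Suc n)
  let ?M = "bernoulli_measure p"
  interpret prob_space ?M by (rule prob_space_bernoulli)
  define r where "r = (1 - p) / p"
  have r: "p * r = 1 - p" using p by (simp add: r_def)
  define i where "i = m + int n"
  define E where "E x \<longleftrightarrow> (\<forall>j\<in>{m..<i}. departures x j \<in> A j)" for x
  define W where "W = (\<Prod>j\<in>{m..<i}. measure_pmf.prob (bernoulli_pmf (1 - p)) (A j))"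
  have [measurable]: "Measurable.pred ?M E"
    unfolding E_def by measurable
  have IH: "prob {x. E x \<and> queue_ge k x i} = W * r ^ k" for k
    using Suc.IH by (simp add: E_def W_def i_def r_def)
  have E_upd: "E (x(i := b)) = E x" for x b
    by (auto simp: E_def departures_fun_upd)
  have indep: "prob {x. (E x \<and> queue_ge k x i) \<and> x i = c} = (if c then p else 1 - p) * (W * r ^ k)"
    for k c
    using bernoulli_independent_coordinate[of p "\<lambda>x. E x \<and> queue_ge k x i" i c] p
    by (simp add: IH E_upd queue_ge_fun_upd)
  \<comment> \<open>A departure leaving at least \<open>k\<close> customers is a service that finds
    at least \<open>k + 1\<close>; its weight is
    \<open>p * r ^ Suc k = (1 - p) * r ^ k\<close>.\<close>
  have true: "prob {x. E x \<and> departures x i \<and> queue_ge k x (i + 1)} = (1 - p) * (W * r ^ k)"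
  proof -
    have "{x. E x \<and> departures x i \<and> queue_ge k x (i + 1)} =
        {x. (E x \<and> queue_ge (Suc k) x i) \<and> x i = True}"
      by (cases k) (auto simp: departures_def queue_ge_step intro: queue_ge_antimono)
    then show ?thesis
      by (simp add: indep[of "Suc k" True, simplified] r[symmetric])
  qed
  have false: "prob {x. E x \<and> \<not> departures x i \<and> queue_ge k x (i + 1)} = p * (W * r ^ k)"
  proof (cases k)
    case 0
    have "{x. E x \<and> \<not> departures x i \<and> queue_ge k x (i + 1)} =
        {x \<in> space ?M. E x} - {x \<in> space ?M. E x \<and> departures x i}"
      using 0 by auto
    also have "prob \<dots> = prob {x \<in> space ?M. E x} - prob {x \<in> space ?M. E x \<and> departures x i}"
    proof (rule finite_measure_Diff)
      show "{x \<in> space ?M. E x} \<in> sets ?M"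
        by measurable
      show "{x \<in> space ?M. E x \<and> departures x i} \<in> sets ?M"
        by measurable
    qed blast
    finally show ?thesis
      using 0 true IH[of 0] by (simp add: algebra_simps)
  next
    case (Suc l)
    have "{x. E x \<and> \<not> departures x i \<and> queue_ge k x (i + 1)} =
        {x. (E x \<and> queue_ge l x i) \<and> x i = False}"
      using Suc by (auto simp: departures_def queue_ge_step intro: queue_ge_antimono)
    then show ?thesis
      by (simp add: indep[of l False, simplified] Suc r[symmetric])
  qed
  \<comment> \<open>The conditions on \<open>A i\<close> sit inside the events, so that a forbidden
    symbol contributes the empty set and all choices of \<open>A i\<close> are treated at
    once.\<close>
  let ?T = "{x. True \<in> A i \<and> E x \<and> departures x i \<and> queue_ge k x (i + 1)}"
  let ?F = "{x. False \<in> A i \<and> E x \<and> \<not> departures x i \<and> queue_ge k x (i + 1)}"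
  have "{x. (E x \<and> departures x i \<in> A i) \<and> queue_ge k x (i + 1)} = ?T \<union> ?F" (is "?L = ?R")
  proof (rule set_eqI)
    fix x
    show "x \<in> ?L \<longleftrightarrow> x \<in> ?R"
      by (cases "departures x i") auto
  qed
  moreover have "prob (?T \<union> ?F) = prob ?T + prob ?F"
  proof (rule finite_measure_Union)
    have "{x \<in> space ?M. True \<in> A i \<and> E x \<and> departures x i \<and> queue_ge k x (i + 1)} \<in> sets ?M"
      by measurable
    then show "?T \<in> sets ?M"
      by simp
    have "{x \<in> space ?M. False \<in> A i \<and> E x \<and> \<not> departures x i \<and> queue_ge k x (i + 1)} \<in> sets ?M"
      by measurable
    then show "?F \<in> sets ?M"
      by simp
  qed blast
  moreover have "prob ?T = (if True \<in> A i then 1 - p else 0) * (W * r ^ k)"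
    using true by (cases "True \<in> A i") simp_all
  moreover have "prob ?F = (if False \<in> A i then p else 0) * (W * r ^ k)"
    using false by (cases "False \<in> A i") simp_all
  moreover have "measure_pmf.prob (bernoulli_pmf (1 - p)) (A i) =
      (if True \<in> A i then 1 - p else 0) + (if False \<in> A i then p else 0)"
    using p by (simp add: prob_bernoulli_pmf)
  ultimately have *: "prob {x. (E x \<and> departures x i \<in> A i) \<and> queue_ge k x (i + 1)} =
      measure_pmf.prob (bernoulli_pmf (1 - p)) (A i) * (W * r ^ k)"
    by (simp only: ring_distribs)
  have interval: "{m..<m + int (Suc n)} = insert i {m..<i}" and endpoint: "m + int (Suc n) = i + 1"
    by (auto simp: i_def)
  show ?case
  proof -
    have "{x. (\<forall>j\<in>insert i {m..<i}. departures x j \<in> A j) \<and> queue_ge k x (i + 1)} =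
        {x. (E x \<and> departures x i \<in> A i) \<and> queue_ge k x (i + 1)}"
      by (auto simp: E_def)
    moreover have "(\<Prod>j\<in>insert i {m..<i}. measure_pmf.prob (bernoulli_pmf (1 - p)) (A j)) =
        measure_pmf.prob (bernoulli_pmf (1 - p)) (A i) * W"
      by (simp add: W_def i_def)
    ultimately show ?thesis
      unfolding interval unfolding endpoint using * by (simp only: r_def mult.assoc)
  qed
qed

lemma distr_departures:
  assumes p: "1/2 < p" "p < 1"
  shows "distr (bernoulli_measure p) (bernoulli_measure (1 - p)) departures = bernoulli_measure (1 - p)"
proof (rule bernoulli_measure_eqI)
  interpret prob_space "bernoulli_measure p" by (rule prob_space_bernoulli)
  fix J :: "int set" and A :: "int \<Rightarrow> bool set"
  assume J: "finite J"
  \<comment> \<open>Inserting 0 keeps minimum and maximum meaningful when \<open>J\<close> is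
    empty.\<close>
  define m where "m = Min (insert 0 J)"
  define n where "n = nat (Max (insert 0 J) + 1 - m)"
  have "m \<le> j \<and> j \<le> Max (insert 0 J)" if "j \<in> J" for j
    using that J by (simp add: m_def)
  then have sub: "J \<subseteq> {m..<m + int n}"
    by (force simp: n_def)
  \<comment> \<open>Padding \<open>J\<close> to an interval: the added coordinates are unconstrained
    and contribute factors 1. The queue condition is made void by \<open>k = 0\<close>.\<close>
  define B where "B j = (if j \<in> J then A j else UNIV)" for j
  have "{x. \<forall>j\<in>J. x j \<in> A j} = {x \<in> space (bernoulli_measure (1 - p)). \<forall>j\<in>J. x j \<in> A j}"
    by simp
  also have "\<dots> \<in> sets (bernoulli_measure (1 - p))"
    using J by measurable
  finally have "emeasure (distr (bernoulli_measure p) (bernoulli_measure (1 - p)) departures)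
      {x. \<forall>j\<in>J. x j \<in> A j} = emeasure (bernoulli_measure p) {x. \<forall>j\<in>J. departures x j \<in> A j}"
    by (simp add: emeasure_distr[OF departures_measurable] vimage_def)
  also have "{x. \<forall>j\<in>J. departures x j \<in> A j} =
      {x. (\<forall>j\<in>{m..<m + int n}. departures x j \<in> B j) \<and> queue_ge 0 x (m + int n)}"
    using sub by (auto simp: B_def)
  also have "emeasure (bernoulli_measure p) \<dots> =
      ennreal (\<Prod>j\<in>{m..<m + int n}. measure_pmf.prob (bernoulli_pmf (1 - p)) (B j))"
    unfolding emeasure_eq_measure prob_departures_queue_ge[OF p] by simp
  also have "(\<Prod>j\<in>{m..<m + int n}. measure_pmf.prob (bernoulli_pmf (1 - p)) (B j)) =
      (\<Prod>j\<in>J. measure_pmf.prob (bernoulli_pmf (1 - p)) (A j))"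
    using sub by (intro prod.mono_neutral_cong_right) (auto simp: B_def)
  finally show "emeasure (distr (bernoulli_measure p) (bernoulli_measure (1 - p)) departures)
      {x. \<forall>j\<in>J. x j \<in> A j} = ennreal (\<Prod>j\<in>J. measure_pmf.prob (bernoulli_pmf (1 - p)) (A j))" .
qed simp

subsection \<open>Inversion\<close>

text \<open>Backwards in time the departures \<open>y\<close> act as arrivals and the other times as
  services; the services used there become the zeros of the result, that is, the arrivals of the
  forward queue.\<close>

definition arrivals :: "(int \<Rightarrow> bool) \<Rightarrow> (int \<Rightarrow> bool)" where
  "arrivals y = reversal (departures (reversal y))"

lemma arrivals_measurable:
  "arrivals \<in> measurable (bernoulli_measure q) (bernoulli_measure q')"
  unfolding arrivals_def
  using measurable_compose[OF measurable_compose[OF reversal_measurable departures_measurable]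
    reversal_measurable] .

lemma arrivals_bshift: "arrivals (bshift y) = bshift (arrivals y)"
proof -
  \<comment> \<open>Reversal conjugates the shift to its inverse, stated here in terms of the shift
    alone.\<close>
  have rev: "bshift (reversal (bshift x)) = reversal x" for x
    by (simp add: bshift_def reversal_def fun_eq_iff)
  have "bshift (departures (reversal (bshift y))) = departures (reversal y)"
    by (simp add: departures_bshift[symmetric] rev)
  then have "bshift (arrivals y) = bshift (reversal (bshift (departures (reversal (bshift y)))))"
    by (simp add: arrivals_def)
  then show ?thesis
    by (simp add: rev) (simp add: arrivals_def)
qed

lemma distr_arrivals:
  assumes p: "1/2 < p" "p < 1"
  shows "distr (bernoulli_measure (1 - p)) (bernoulli_measure p) arrivals = bernoulli_measure p"
proof -
  have "distr (bernoulli_measure (1 - p)) (bernoulli_measure p) arrivals =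
      distr (distr (distr (bernoulli_measure (1 - p)) (bernoulli_measure p) reversal)
        (bernoulli_measure (1 - p)) departures) (bernoulli_measure p) reversal"
    unfolding arrivals_def
    by (simp add: distr_distr departures_measurable reversal_measurable
        o_def measurable_compose[OF reversal_measurable departures_measurable])
  also have "\<dots> = bernoulli_measure p"
    using p distr_reversal[of p] distr_reversal[of "1 - p"] distr_departures[OF p] by simp
  finally show ?thesis .
qed

lemma queue_ge_reversed_departures:
  "queue_ge k (reversal (departures x)) (1 - i) \<Longrightarrow> queue_ge k x i"
proof -
  have "k \<le> queue n (reversal (departures x)) (1 - i) \<Longrightarrow> queue_ge k x i" for n
  proof (induction n arbitrary: k i)
    case (Suc n)
    show ?case
    proof (cases k)
      case (Suc l)
      note IH = Suc.IH[of _ "i + 1", simplified]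
      have d: "reversal (departures x) (- i) \<longleftrightarrow> \<not> departures x i"
        by (simp add: reversal_def)
      show ?thesis
      proof (cases "departures x i")
        case True
        then have "queue_ge l x (i + 1)"
          using Suc.prems IH[of l] Suc d by simp
        with True show ?thesis
          using Suc by (cases l) (auto simp: departures_def queue_ge_step)
      next
        case False
        then have "queue_ge (Suc k) x (i + 1)"
          using Suc.prems IH[of "Suc k"] Suc d by simp
        then show ?thesis
          by (auto simp: queue_ge_step split: if_splits intro: queue_ge_antimono)
      qed
    qed simp
  qed simp
  then show "queue_ge k (reversal (departures x)) (1 - i) \<Longrightarrow> queue_ge k x i"
    unfolding queue_ge_def[of k "reversal (departures x)"] by blast
qed

text \<open>By Burke's theorem \<open>reversal\<close> after \<open>departures\<close> preserves the
  measure, and the tail probability is the same at all times. Hence both events have equal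
  probability, one contains the other, and their difference is null.\<close>

lemma AE_queue_ge_reversed_departures:
  assumes p: "1/2 < p" "p < 1"
  shows "AE x in bernoulli_measure p.
    queue_ge k x i \<longleftrightarrow> queue_ge k (reversal (departures x)) (1 - i)"
proof -
  let ?M = "bernoulli_measure p"
  interpret prob_space ?M by (rule prob_space_bernoulli)
  let ?f = "\<lambda>x. reversal (departures x)"
  have f: "?f \<in> measurable ?M ?M"
    by (rule measurable_compose[OF departures_measurable reversal_measurable])
  have "distr ?M ?M ?f = distr (distr ?M (bernoulli_measure (1 - p)) departures) ?M reversal"
    by (simp add: distr_distr departures_measurable reversal_measurable o_def)
  then have distr_f: "distr ?M ?M ?f = ?M"
    using p distr_reversal[of "1 - p"] distr_departures[OF p] by simp
  let ?Q = "{x \<in> space ?M. queue_ge k x i}" and ?R = "{x \<in> space ?M. queue_ge k (?f x) (1 - i)}"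
  have Q: "?Q \<in> sets ?M" by measurable
  have T: "{x \<in> space ?M. queue_ge k x (1 - i)} \<in> sets ?M" by measurable
  have R_eq: "?R = ?f -` {x \<in> space ?M. queue_ge k x (1 - i)} \<inter> space ?M"
    by auto
  then have R: "?R \<in> sets ?M"
    using measurable_sets[OF f T] by simp
  have "prob ?R = measure (distr ?M ?M ?f) {x \<in> space ?M. queue_ge k x (1 - i)}"
    unfolding R_eq by (rule measure_distr[OF f T, symmetric])
  then have "prob ?R = prob ?Q"
    by (simp add: distr_f prob_queue_ge[OF p])
  moreover have "?R \<subseteq> ?Q"
    using queue_ge_reversed_departures by auto
  ultimately have "prob (?Q - ?R) = 0"
    using finite_measure_Diff[OF Q R] by simp
  then have "AE x in ?M. x \<notin> ?Q - ?R"
    using Q R by (intro AE_not_in) (auto simp: null_sets_def emeasure_eq_measure)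
  then show ?thesis
    by eventually_elim (auto dest: queue_ge_reversed_departures)
qed

lemma AE_arrivals_departures:
  assumes p: "1/2 < p" "p < 1"
  shows "AE x in bernoulli_measure p. arrivals (departures x) = x"
proof -
  have "AE x in bernoulli_measure p. \<forall>i.
      queue_ge 1 x i \<longleftrightarrow> queue_ge 1 (reversal (departures x)) (1 - i)"
    unfolding AE_all_countable using AE_queue_ge_reversed_departures[OF p] by blast
  then show ?thesis
  proof eventually_elim
    case (elim x)
    show ?case
    proof
      fix i
      have "arrivals (departures x) i \<longleftrightarrow> departures x i \<or> \<not> queue_ge 1 x (i + 1)"
        using elim[rule_format, of "i + 1"] by (simp add: arrivals_def) (auto simp: reversal_def departures_def)
      then show "arrivals (departures x) i = x i"
        using queue_ge_step[of 0 x i] queue_ge_antimono[of 2 x i 1]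
        by (auto simp: departures_def numeral_2_eq_2)
    qed
  qed
qed

text \<open>The composition in this order is the previous one conjugated by \<open>reversal\<close>,
  which carries one Bernoulli measure to the other.\<close>

lemma AE_departures_arrivals:
  assumes p: "1/2 < p" "p < 1"
  shows "AE y in bernoulli_measure (1 - p). departures (arrivals y) = y"
proof -
  have "AE x in distr (bernoulli_measure (1 - p)) (bernoulli_measure p) reversal.
      arrivals (departures x) = x"
  proof -
    have "distr (bernoulli_measure (1 - p)) (bernoulli_measure p) reversal = bernoulli_measure p"
      using distr_reversal[of "1 - p"] p by simp
    then show ?thesis
      using AE_arrivals_departures[OF p] by (simp only:)
  qed
  then have "AE y in bernoulli_measure (1 - p). arrivals (departures (reversal y)) = reversal y"
    by (rule AE_distrD[OF reversal_measurable])
  then show ?thesis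
  proof eventually_elim
    case (elim y)
    then have "reversal (departures (arrivals y)) = reversal y"
      by (simp add: arrivals_def)
    then show ?case
      by (metis reversal_reversal)
  qed
qed

theorem theorem1:
  fixes p :: real
  assumes "1/2 < p" and "p < 1"
  shows "\<exists>\<phi>. monotone_map \<phi> \<and>
           isomorphism (bernoulli_measure p) (bernoulli_measure (1 - p)) \<phi>"
proof (intro exI conjI)
  show "monotone_map departures"
    by (simp add: monotone_map_def departures_def)
  have "factor_map (bernoulli_measure p) (bernoulli_measure (1 - p)) departures"
    using departures_measurable distr_departures[OF assms]
    by (simp add: factor_map_def departures_bshift)
  moreover have "factor_map (bernoulli_measure (1 - p)) (bernoulli_measure p) arrivals"
    using arrivals_measurable distr_arrivals[OF assms]
    by (simp add: factor_map_def arrivals_bshift)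
  ultimately show "isomorphism (bernoulli_measure p) (bernoulli_measure (1 - p)) departures"
    unfolding isomorphism_def
    using AE_arrivals_departures[OF assms] AE_departures_arrivals[OF assms] by blast
qed

end
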